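(* Let $M$ be an $n\times n$ integer matrix with $|\det M|=2$ and all eigenvalues of modulus $>1$, let $e\in\mathbb Z^n\setminus M\mathbb Z^n$, $k_1=-\tfrac12 e$, $k_2=\tfrac12 e$, $f_j(x)=M^{-1}(x+k_j)$, and $T=f_1(T)\cup f_2(T)$ the corresponding twindragon, with neighbor graph $G=(V,E)$. Suppose $0=v_0,v_1,v_2,\dots$ is an infinite sequence in $V$ and $s_1s_2\dots\in\{1,2\}^{\mathbb N}$ such that for every $t\ge1$, $$v_t=Mv_{t-1}+k_{3-s_t}-k_{s_t}$$ (i.e. an infinite directed path in $G$ from the root with labels $s_1s_2\dots$ using no "double arrow" $v_t=Mv_{t-1}$). Then $\pi(s_1s_2\dots)=0$, the symmetry center of $T$.
   Context: $B_k=T\cap(T+k)$. Neighbor graph $G=(V,E)$: $V=\{k\in\mathbb Z^n: B_k\neq\emptyset\}$; for $k,k'\in V$ there is an edge from $k$ to $k'$ with label $i\in\{1,2\}$ iff $k'=Mk+k_j-k_i$ for some $j\in\{1,2\}$. The address map is $\pi(s_1s_2\dots)=\bigcap_q f_{s_1}\circ\dots\circ f_{s_q}(T)$. $T=-T$. *)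

theory Defs
  imports "HOL-Analysis.Analysis"
begin

text \<open>Integer lattice Z^n inside R^n.\<close>
definition int_lattice :: "(real ^ 'n) set" where
  "int_lattice = {x. \<forall>i. x $ i \<in> \<int>}"

definition int_matrix :: "real ^ 'n ^ 'n \<Rightarrow> bool" where
  "int_matrix M \<longleftrightarrow> (\<forall>i j. M $ i $ j \<in> \<int>)"

text \<open>Complexification of a real matrix; eigenvalues are the complex roots of the
  characteristic polynomial.\<close>
definition cmat :: "real ^ 'n ^ 'n \<Rightarrow> complex ^ 'n ^ 'n" where
  "cmat M = (\<chi> i j. complex_of_real (M $ i $ j))"

definition is_eigenvalue :: "real ^ 'n ^ 'n \<Rightarrow> complex \<Rightarrow> bool" where
  "is_eigenvalue M z \<longleftrightarrow> det (mat z - cmat M) = 0"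

text \<open>Translation vectors k_1 = -e/2, k_2 = e/2 (indices 1,2).\<close>
definition kvec :: "real ^ 'n \<Rightarrow> nat \<Rightarrow> real ^ 'n" where
  "kvec e j = (if j = 1 then - ((1/2) *\<^sub>R e) else (1/2) *\<^sub>R e)"

text \<open>f_j(x) = M^{-1}(x + k_j).\<close>
definition ifs_map :: "real ^ 'n ^ 'n \<Rightarrow> real ^ 'n \<Rightarrow> nat \<Rightarrow> real ^ 'n \<Rightarrow> real ^ 'n" where
  "ifs_map M e j x = matrix_inv M *v (x + kvec e j)"

text \<open>f_{s_1} o ... o f_{s_q}.\<close>
fun ifs_comp :: "real ^ 'n ^ 'n \<Rightarrow> real ^ 'n \<Rightarrow> (nat \<Rightarrow> nat) \<Rightarrow> nat \<Rightarrow> real ^ 'n \<Rightarrow> real ^ 'n" where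
  "ifs_comp M e s 0 = id"
| "ifs_comp M e s (Suc q) = ifs_comp M e s q \<circ> ifs_map M e (s (Suc q))"

text \<open>Address map pi(s_1 s_2 ...) = Inter_q f_{s_1} o ... o f_{s_q}(T).\<close>
definition address :: "real ^ 'n ^ 'n \<Rightarrow> real ^ 'n \<Rightarrow> (real ^ 'n) set \<Rightarrow> (nat \<Rightarrow> nat) \<Rightarrow> (real ^ 'n) set" where
  "address M e T s = (\<Inter>q\<in>{1..}. ifs_comp M e s q ` T)"

text \<open>Vertex set of the neighbor graph: k in Z^n with T \<inter> (T + k) nonempty.\<close>
definition neighbor_vertices :: "(real ^ 'n) set \<Rightarrow> (real ^ 'n) set" where
  "neighbor_vertices T = {k \<in> int_lattice. T \<inter> ((\<lambda>x. x + k) ` T) \<noteq> {}}"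

end

theory Submission
  imports Defs "HOL-Computational_Algebra.Fundamental_Theorem_Algebra"
begin

(*
  Proof idea.  Write L = (\<lambda>x. M *v x) and F_q = f_{s_1} o ... o f_{s_q}.  Since
  k_{3-s} - k_s = -2 k_s, the path condition reads v_{q+1} = M v_q - 2 k_{s_{q+1}},
  and an induction on q gives the conjugation identity
      L^q (F_q y) = y - v_q / 2      for all y.
  Both T and the vertices of the neighbour graph are bounded (a vertex is a difference
  of two points of T), so every point x of pi(s) = \<Inter>_q F_q(T) has a bounded orbit
  under L.  An expanding matrix has no nonzero bounded orbit; hence pi(s) \<subseteq> {0}.
  Finally pi(s) is a decreasing intersection of nonempty compact sets, so it is nonempty.
*)

section \<open>Polynomials in a matrix applied to a vector\<close>

text \<open>\<open>peval A P u\<close> is the vector \<open>P(A) u\<close>.\<close>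
definition peval :: "complex^'n^'n \<Rightarrow> complex poly \<Rightarrow> complex^'n \<Rightarrow> complex^'n" where
  "peval A P u = (\<Sum>i\<le>degree P. coeff P i *s (((*v) A) ^^ i) u)"

text \<open>The defining sum may be extended by any number of zero coefficients.\<close>
lemma peval_bound:
  assumes "degree P \<le> N"
  shows "peval A P u = (\<Sum>i\<le>N. coeff P i *s (((*v) A) ^^ i) u)"
  unfolding peval_def
proof (rule sum.mono_neutral_left)
  show "\<forall>i\<in>{..N} - {..degree P}. coeff P i *s (((*v) A) ^^ i) u = 0"
    by (auto simp: coeff_eq_0)
qed (use assms in auto)

lemma peval_add: "peval A (P + Q) u = peval A P u + peval A Q u"
proof -
  let ?N = "max (degree P) (degree Q)"
  have "degree (P + Q) \<le> ?N" by (rule degree_add_le) auto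
  then show ?thesis
    by (simp add: peval_bound[of _ ?N] sum.distrib vec.scale_left_distrib)
qed

lemma peval_smult: "peval A (smult c P) u = c *s peval A P u"
proof -
  have "degree (smult c P) \<le> degree P" by (rule degree_smult_le)
  then show ?thesis
    by (simp add: peval_bound[of _ "degree P"] peval_def vec.scale_sum_right vec.scale_scale)
qed

text \<open>Multiplying the polynomial by the variable corresponds to applying \<open>A\<close>.\<close>
lemma peval_pCons0: "peval A (pCons 0 P) u = A *v peval A P u"
proof -
  have "degree (pCons 0 P) \<le> Suc (degree P)" by (rule degree_pCons_le)
  then have "peval A (pCons 0 P) u
      = (\<Sum>i\<le>Suc (degree P). coeff (pCons 0 P) i *s (((*v) A) ^^ i) u)"
    by (rule peval_bound)
  also have "\<dots> = (\<Sum>i\<le>degree P. coeff P i *s (((*v) A) ^^ Suc i) u)"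
    unfolding sum.atMost_Suc_shift by (simp del: funpow.simps)
  also have "\<dots> = A *v peval A P u"
    by (simp add: peval_def vec.sum vector_scalar_commute)
  finally show ?thesis .
qed

text \<open>Splitting off a linear factor: \<open>((X - a) Q)(A) u = (A - a) Q(A) u\<close>.\<close>
lemma peval_linear_factor:
  "peval A ([:-a, 1:] * Q) u = A *v peval A Q u - a *s peval A Q u"
proof -
  have factor: "[:-a, 1:] * Q = pCons 0 Q + smult (-a) Q" by simp
  show ?thesis unfolding factor peval_add peval_smult peval_pCons0
    by (simp add: vec.scale_minus_left)
qed

lemma peval_const: "degree P = 0 \<Longrightarrow> peval A P u = coeff P 0 *s u"
  by (simp add: peval_def)

lemma peval_monom1: "peval A (monom 1 i) u = (((*v) A) ^^ i) u"
proof -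
  have "peval A (monom 1 i) u = (\<Sum>k\<le>i. if k = i then (((*v) A) ^^ k) u else 0)"
    unfolding peval_def by (intro sum.cong) (auto simp: degree_monom_eq coeff_monom)
  then show ?thesis by simp
qed

section \<open>Vectors with bounded orbit\<close>

definition bounded_orbit :: "complex^'n^'n \<Rightarrow> complex^'n \<Rightarrow> bool" where
  "bounded_orbit A u \<longleftrightarrow> (\<exists>B. \<forall>q i. cmod (((((*v) A) ^^ q) u) $ i) \<le> B)"

lemma bounded_orbit_funpow: "bounded_orbit A u \<Longrightarrow> bounded_orbit A ((((*v) A) ^^ k) u)"
  unfolding bounded_orbit_def by (metis funpow_add o_apply)

lemma bounded_orbit_scale:
  assumes "bounded_orbit A u"
  shows "bounded_orbit A (c *s u)"
proof -
  obtain B where B: "\<And>q i. cmod (((((*v) A) ^^ q) u) $ i) \<le> B"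
    using assms unfolding bounded_orbit_def by blast
  have "(((*v) A) ^^ q) (c *s u) = c *s (((*v) A) ^^ q) u" for q
    by (induction q) (simp_all add: vector_scalar_commute)
  then have "cmod (((((*v) A) ^^ q) (c *s u)) $ i) \<le> cmod c * B" for q i
    by (simp add: norm_mult B mult_left_mono)
  then show ?thesis unfolding bounded_orbit_def by blast
qed

lemma bounded_orbit_add:
  assumes "bounded_orbit A u" "bounded_orbit A w"
  shows "bounded_orbit A (u + w)"
proof -
  obtain B C where B: "\<And>q i. cmod (((((*v) A) ^^ q) u) $ i) \<le> B"
    and C: "\<And>q i. cmod (((((*v) A) ^^ q) w) $ i) \<le> C"
    using assms unfolding bounded_orbit_def by blast
  have "(((*v) A) ^^ q) (u + w) = (((*v) A) ^^ q) u + (((*v) A) ^^ q) w" for q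
    by (induction q) (simp_all add: matrix_vector_right_distrib)
  then have "cmod (((((*v) A) ^^ q) (u + w)) $ i) \<le> B + C" for q i
    using norm_triangle_le[OF add_mono[OF B C]] by simp
  then show ?thesis unfolding bounded_orbit_def by blast
qed

lemma bounded_orbit_zero: "bounded_orbit A 0"
proof -
  have "(((*v) A) ^^ q) 0 = 0" for q by (induction q) simp_all
  then show ?thesis unfolding bounded_orbit_def by auto
qed

lemma bounded_orbit_sum:
  "finite S \<Longrightarrow> (\<And>x. x \<in> S \<Longrightarrow> bounded_orbit A (f x)) \<Longrightarrow> bounded_orbit A (sum f S)"
  by (induction S rule: finite_induct) (auto intro: bounded_orbit_add bounded_orbit_zero)

text \<open>Vectors with bounded orbit form an \<open>A\<close>-invariant subspace, hence are stable
  under every polynomial in \<open>A\<close>.\<close>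
lemma bounded_orbit_peval: "bounded_orbit A u \<Longrightarrow> bounded_orbit A (peval A P u)"
  unfolding peval_def
  by (intro bounded_orbit_sum bounded_orbit_scale bounded_orbit_funpow) auto

section \<open>Eigenvectors with bounded orbit\<close>

text \<open>The vectors \<open>u, Au, \<dots>, A^N u\<close> with \<open>N = n\<close> are linearly dependent, so every
  vector is annihilated by a nonzero polynomial.  First the case of pairwise distinct
  iterates.\<close>
lemma annihilator_of_distinct_iterates:
  fixes A :: "complex^'n^'n"
  assumes inj: "inj_on (\<lambda>i. (((*v) A) ^^ i) u) {..CARD('n)}"
  shows "\<exists>P. P \<noteq> 0 \<and> peval A P u = 0"
proof -
  define N where "N = CARD('n)"
  define G where "G = (*v) A"
  define S where "S = (\<lambda>i. (G ^^ i) u) ` {..N}"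
  have inj_G: "inj_on (\<lambda>i. (G ^^ i) u) {..N}" using inj by (simp add: G_def N_def)
  have "vec.dependent S"
  proof (rule ccontr)
    assume "vec.independent S"
    then have "card S \<le> vec.dim (UNIV :: (complex^'n) set)"
      using vec.independent_bound_general vec.dim_subset[of S UNIV] by fastforce
    also have "\<dots> = N" by (simp add: vec.dim_UNIV N_def card_cart_basis)
    finally show False using card_image[OF inj_G] by (simp add: S_def)
  qed
  then obtain c where c: "\<exists>v\<in>S. c v \<noteq> 0" "(\<Sum>v\<in>S. c v *s v) = 0"
    using vec.dependent_finite[of S] by (auto simp: S_def)
  define P where "P = (\<Sum>k\<le>N. monom (c ((G ^^ k) u)) k)"
  have coeff_P: "k \<le> N \<Longrightarrow> coeff P k = c ((G ^^ k) u)" for k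
    unfolding P_def by (rule coeff_sum_monom)
  have deg_P: "degree P \<le> N"
    by (rule degree_le) (auto simp: P_def coeff_sum coeff_monom)
  from c(1) obtain k where "k \<le> N" "c ((G ^^ k) u) \<noteq> 0" unfolding S_def by blast
  then have "P \<noteq> 0" using coeff_P by force
  moreover have "peval A P u = 0"
  proof -
    have "peval A P u = (\<Sum>k\<le>N. c ((G ^^ k) u) *s (G ^^ k) u)"
      unfolding peval_bound[OF deg_P] G_def[symmetric] by (intro sum.cong) (auto simp: coeff_P)
    also have "\<dots> = (\<Sum>v\<in>S. c v *s v)"
      unfolding S_def by (rule sum.reindex[OF inj_G, symmetric, unfolded o_def])
    finally show ?thesis using c(2) by simp
  qed
  ultimately show ?thesis by blast
qed

lemma exists_annihilator:
  fixes A :: "complex^'n^'n"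
  shows "\<exists>P. P \<noteq> 0 \<and> peval A P u = 0"
proof (cases "inj_on (\<lambda>i. (((*v) A) ^^ i) u) {..CARD('n)}")
  case False
  then obtain i j where ij: "i \<noteq> j" "(((*v) A) ^^ i) u = (((*v) A) ^^ j) u"
    unfolding inj_on_def by blast
  define P where "P = (monom 1 i + smult (-1) (monom 1 j) :: complex poly)"
  have "coeff P i = 1" using ij by (simp add: P_def coeff_monom)
  then have "P \<noteq> 0" by auto
  moreover have "peval A P u = 0"
    unfolding P_def peval_add peval_smult peval_monom1 using ij(2) by simp
  ultimately show ?thesis by blast
qed (rule annihilator_of_distinct_iterates)

text \<open>If a nonzero vector with bounded orbit is annihilated by \<open>P \<noteq> 0\<close>, peel off the
  linear factors of \<open>P\<close> (fundamental theorem of algebra) until one of them kills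
  \<open>Q(A) u \<noteq> 0\<close>; that vector is an eigenvector with bounded orbit.\<close>
lemma bounded_orbit_eigenvector:
  assumes "bounded_orbit A u" "u \<noteq> 0" "P \<noteq> 0" "peval A P u = 0"
  shows "\<exists>a w. w \<noteq> 0 \<and> A *v w = a *s w \<and> bounded_orbit A w"
  using assms(3,4)
proof (induction "degree P" arbitrary: P rule: less_induct)
  case less
  show ?case
  proof (cases "degree P = 0")
    case True
    then have "coeff P 0 \<noteq> 0" using less.prems(1) by (metis leading_coeff_0_iff)
    then show ?thesis
      using less.prems(2) peval_const[OF True, of A u] assms(2) by (simp add: vec.scale_eq_0_iff)
  next
    case False
    then obtain a where "poly P a = 0"
      using fundamental_theorem_of_algebra[of P] constant_degree[of P] by auto
    then obtain Q where Q: "P = [:-a, 1:] * Q" by (metis poly_eq_0_iff_dvd dvdE)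
    have "Q \<noteq> 0" using less.prems(1) Q by auto
    then have "degree ([:-a, 1:] * Q) = degree [:-a, 1:] + degree Q"
      by (intro degree_mult_eq) auto
    then have "degree Q < degree P" using Q by simp
    show ?thesis
    proof (cases "peval A Q u = 0")
      case True
      then show ?thesis using less.hyps \<open>degree Q < degree P\<close> \<open>Q \<noteq> 0\<close> by blast
    next
      case False
      have "A *v peval A Q u = a *s peval A Q u"
        using less.prems(2) Q peval_linear_factor[of A a Q u] by simp
      then show ?thesis using False bounded_orbit_peval[OF assms(1)] by blast
    qed
  qed
qed

text \<open>An eigenvector with bounded orbit has an eigenvalue of modulus at most one,
  since its orbit is \<open>a^q w\<close>.\<close>
lemma eigenvalue_of_bounded_orbit:
  assumes "w \<noteq> 0" "A *v w = a *s w" "bounded_orbit A w"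
  shows "cmod a \<le> 1"
proof (rule ccontr)
  assume "\<not> cmod a \<le> 1"
  obtain B where B: "\<And>q i. cmod (((((*v) A) ^^ q) w) $ i) \<le> B"
    using assms(3) unfolding bounded_orbit_def by blast
  obtain j where j: "w $ j \<noteq> 0" using assms(1) by (metis vec_eq_iff zero_index)
  have orbit: "(((*v) A) ^^ q) w = a ^ q *s w" for q
    by (induction q) (simp_all add: assms(2) vector_scalar_commute vec.scale_scale mult.commute)
  obtain q where q: "B / cmod (w $ j) < cmod a ^ q"
    using real_arch_pow[of "cmod a" "B / cmod (w $ j)"] \<open>\<not> cmod a \<le> 1\<close> by auto
  have "cmod a ^ q * cmod (w $ j) \<le> B"
    using B[of q j] by (simp add: orbit norm_mult norm_power)
  then have "cmod a ^ q \<le> B / cmod (w $ j)" using j by (simp add: pos_le_divide_eq)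
  with q show False by simp
qed

lemma mat_mult_vector: "mat a *v (w::'a::comm_ring_1^'n) = a *s w"
proof -
  have "(\<Sum>j\<in>UNIV. (if i = j then a else 0) * w $ j) = a * w $ i" for i
  proof -
    have "(\<Sum>j\<in>UNIV. (if i = j then a else 0) * w $ j) = (\<Sum>j\<in>UNIV. if i = j then a * w $ j else 0)"
      by (rule sum.cong) auto
    then show ?thesis by simp
  qed
  then show ?thesis by (simp add: vec_eq_iff matrix_vector_mult_def mat_def)
qed

text \<open>An eigenvalue in the sense of eigenvectors is a root of the characteristic
  polynomial.\<close>
lemma eigenvector_det:
  assumes "w \<noteq> 0" "A *v w = a *s w"
  shows "det (mat a - A) = (0::'a::field)"
proof -
  let ?f = "(*v) (mat a - A)"
  have "?f w = ?f 0"
    by (simp add: matrix_vector_mult_diff_rdistrib mat_mult_vector assms(2))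
  then have "\<not> inj ?f" using assms(1) by (metis injD)
  then show ?thesis
    using det_nz_iff_inj_gen[OF matrix_vector_mul_linear_gen, of "mat a - A"]
    by (simp add: matrix_of_matrix_vector_mul)
qed

text \<open>Main linear-algebra fact: a real matrix all of whose eigenvalues lie outside
  the closed unit disc has no nonzero bounded orbit.\<close>
theorem expanding_bounded_orbit_zero:
  fixes M :: "real^'n^'n" and p :: "real^'n"
  assumes eig: "\<forall>z. is_eigenvalue M z \<longrightarrow> 1 < cmod z"
    and bnd: "\<And>q. norm ((((*v) M) ^^ q) p) \<le> B"
  shows "p = 0"
proof (rule ccontr)
  assume "p \<noteq> 0"
  define cv :: "real^'n \<Rightarrow> complex^'n" where "cv x = (\<chi> i. complex_of_real (x $ i))" for x
  define A where "A = cmat M"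
  have "A *v cv x = cv (M *v x)" for x
    by (simp add: A_def cmat_def cv_def vec_eq_iff matrix_vector_mult_def)
  then have orbit: "(((*v) A) ^^ q) (cv p) = cv ((((*v) M) ^^ q) p)" for q
    by (induction q) simp_all
  have "cmod ((((*v) A) ^^ q) (cv p) $ i) \<le> B" for q i
    using component_le_norm_cart[of "(((*v) M) ^^ q) p" i] bnd[of q]
    unfolding orbit by (simp add: cv_def)
  then have bounded: "bounded_orbit A (cv p)" unfolding bounded_orbit_def by blast
  have "cv p \<noteq> 0" using \<open>p \<noteq> 0\<close> by (simp add: cv_def vec_eq_iff)
  obtain P where "P \<noteq> 0" "peval A P (cv p) = 0" using exists_annihilator by blast
  then obtain a w where aw: "w \<noteq> 0" "A *v w = a *s w" "bounded_orbit A w"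
    using bounded_orbit_eigenvector[OF bounded \<open>cv p \<noteq> 0\<close>] by blast
  have "is_eigenvalue M a"
    unfolding is_eigenvalue_def A_def[symmetric] using eigenvector_det[OF aw(1,2)] .
  with eigenvalue_of_bounded_orbit[OF aw] eig show False by force
qed

section \<open>The iterated function system\<close>

text \<open>Since \<open>k_{3-j} = -k_j\<close>, a labelled edge of the neighbour graph without double
  arrow adds \<open>-2 k_j\<close>.\<close>
lemma kvec_opposite:
  assumes "j \<in> {1, 2}"
  shows "kvec e (3 - j) - kvec e j = - (2 *\<^sub>R kvec e j)"
  using assms by (auto simp: kvec_def scaleR_2)

lemma matrix_inv_right:
  "invertible A \<Longrightarrow> A ** matrix_inv A = mat 1"
  unfolding matrix_inv_def invertible_def by (rule someI2_ex) auto

lemma ifs_comp_continuous: "continuous_on UNIV (ifs_comp M e s q)"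
proof (induction q)
  case 0 then show ?case by (simp add: continuous_on_id)
next
  case (Suc q)
  have "continuous_on UNIV (ifs_map M e j)" for j
    unfolding ifs_map_def
    by (intro continuous_on_compose2[OF matrix_vector_mult_linear_continuous_on]
        continuous_intros) auto
  then show ?case using Suc by (auto intro: continuous_on_compose2)
qed

text \<open>The address of any label sequence in \<open>{1,2}\<close> is nonempty: it is the
  intersection of a decreasing sequence of nonempty compact sets.\<close>
lemma address_nonempty:
  assumes "compact T" "T \<noteq> {}" "T = ifs_map M e 1 ` T \<union> ifs_map M e 2 ` T"
    and "\<forall>t\<ge>1. s t \<in> {1, 2}"
  shows "address M e T s \<noteq> {}"
proof -
  define F where "F n = ifs_comp M e s (Suc n) ` T" for n
  have "\<Inter> (range F) \<noteq> {}"
  proof (rule compact_nest)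
    show "compact (F n)" for n
      unfolding F_def using ifs_comp_continuous assms(1)
      by (metis compact_continuous_image continuous_on_subset subset_UNIV)
    show "F n \<noteq> {}" for n using assms(2) by (simp add: F_def)
    have invariant: "ifs_map M e j ` T \<subseteq> T" if "j \<in> {1, 2}" for j
      using that assms(3) by blast
    have "F (Suc n) \<subseteq> F n" for n
      using invariant[of "s (Suc (Suc n))"] assms(4) by (auto simp: F_def)
    then show "m \<le> n \<Longrightarrow> F n \<subseteq> F m" for m n by (rule lift_Suc_antimono_le)
  qed
  moreover have "x \<in> address M e T s" if x: "x \<in> \<Inter> (range F)" for x
    unfolding address_def
  proof
    fix q :: nat assume "q \<in> {1..}"
    then obtain n where "q = Suc n" by (cases q) auto
    have "x \<in> F n" using x by blast
    then show "x \<in> ifs_comp M e s q ` T" unfolding F_def \<open>q = Suc n\<close> .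
  qed
  ultimately show ?thesis by blast
qed

text \<open>Conjugation identity: along the path, \<open>M^q (f_{s_1} o \<dots> o f_{s_q})(y) = y - v_q/2\<close>.\<close>
lemma ifs_comp_conjugation:
  assumes inv: "invertible M" and "v 0 = 0"
    and path: "\<And>q. v (Suc q) = M *v v q - 2 *\<^sub>R kvec e (s (Suc q))"
  shows "(((*v) M) ^^ q) (ifs_comp M e s q y) = y - (1/2) *\<^sub>R v q"
proof (induction q arbitrary: y)
  case 0 then show ?case by (simp add: \<open>v 0 = 0\<close>)
next
  case (Suc q)
  have M_inv: "M *v (matrix_inv M *v x) = x" for x
    by (simp add: matrix_vector_mul_assoc matrix_inv_right[OF inv])
  have "(((*v) M) ^^ Suc q) (ifs_comp M e s (Suc q) y)
      = M *v ((((*v) M) ^^ q) (ifs_comp M e s q (ifs_map M e (s (Suc q)) y)))"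
    by simp
  also have "\<dots> = M *v (ifs_map M e (s (Suc q)) y - (1/2) *\<^sub>R v q)"
    by (simp only: Suc)
  also have "\<dots> = y + kvec e (s (Suc q)) - (1/2) *\<^sub>R (M *v v q)"
    by (simp add: ifs_map_def matrix_vector_mult_diff_distrib matrix_vector_mult_scaleR M_inv)
  also have "\<dots> = y - (1/2) *\<^sub>R v (Suc q)"
    unfolding path by (simp add: scaleR_diff_right)
  finally show ?case .
qed

text \<open>A vertex of the neighbour graph is a difference of two points of \<open>T\<close>.\<close>
lemma neighbor_vertex_norm_le:
  assumes "k \<in> neighbor_vertices T" "\<And>y. y \<in> T \<Longrightarrow> norm y \<le> R"
  shows "norm k \<le> 2 * R"
proof -
  from assms(1) obtain a b where "a \<in> T" "b \<in> T" "a = b + k"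
    unfolding neighbor_vertices_def by blast
  then have "norm k \<le> norm a + norm b" using norm_triangle_ineq4[of a b] by simp
  moreover have "norm a \<le> R" "norm b \<le> R" using assms(2) \<open>a \<in> T\<close> \<open>b \<in> T\<close> by auto
  ultimately show ?thesis by linarith
qed

text \<open>Every point of the address has a bounded orbit under \<open>M\<close>.\<close>
lemma address_orbit_bounded:
  assumes "invertible M" "v 0 = 0"
    and "\<And>q. v (Suc q) = M *v v q - 2 *\<^sub>R kvec e (s (Suc q))"
    and T_bound: "\<And>y. y \<in> T \<Longrightarrow> norm y \<le> R" and v_bound: "\<And>q. norm (v q) \<le> C"
    and x: "x \<in> address M e T s"
  shows "norm ((((*v) M) ^^ q) x) \<le> max (norm x) (R + C / 2)"
proof (cases "q = 0")
  case False
  then have "x \<in> ifs_comp M e s q ` T" using x unfolding address_def by auto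
  then obtain y where y: "y \<in> T" "x = ifs_comp M e s q y" by blast
  then have "(((*v) M) ^^ q) x = y - (1/2) *\<^sub>R v q"
    using ifs_comp_conjugation[OF assms(1-3)] by simp
  then have "norm ((((*v) M) ^^ q) x) \<le> norm y + norm ((1/2) *\<^sub>R v q)"
    using norm_triangle_ineq4 by metis
  also have "\<dots> \<le> R + C / 2" using T_bound[OF y(1)] v_bound[of q] by simp
  finally show ?thesis by simp
qed simp

section \<open>The address of an infinite path without double arrows\<close>

theorem proposition12p3:
  fixes M :: "real ^ 'n ^ 'n" and e :: "real ^ 'n" and T :: "(real ^ 'n) set"
    and v :: "nat \<Rightarrow> real ^ 'n" and s :: "nat \<Rightarrow> nat"
  assumes "int_matrix M"
    and "\<bar>det M\<bar> = 2"
    and "\<forall>z. is_eigenvalue M z \<longrightarrow> 1 < cmod z"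
    and "e \<in> int_lattice" and "e \<notin> (\<lambda>x. M *v x) ` int_lattice"
    and "compact T" and "T \<noteq> {}"
    and "T = ifs_map M e 1 ` T \<union> ifs_map M e 2 ` T"
    and "v 0 = 0"
    and "\<forall>t. v t \<in> neighbor_vertices T"
    and "\<forall>t\<ge>1. s t \<in> {1, 2}"
    and "\<forall>t\<ge>1. v t = M *v v (t - 1) + kvec e (3 - s t) - kvec e (s t)"
  shows "address M e T s = {0}"
proof -
  have inv: "invertible M" using assms(2) invertible_det_nz by force
  have path: "v (Suc q) = M *v v q - 2 *\<^sub>R kvec e (s (Suc q))" for q
  proof -
    have "v (Suc q) = M *v v q + (kvec e (3 - s (Suc q)) - kvec e (s (Suc q)))"
      using assms(12) by (simp add: algebra_simps)
    moreover have "s (Suc q) \<in> {1, 2}" using assms(11) by simp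
    ultimately show ?thesis using kvec_opposite[of "s (Suc q)" e] by simp
  qed
  obtain R where R: "\<And>y. y \<in> T \<Longrightarrow> norm y \<le> R"
    using compact_imp_bounded[OF assms(6)] unfolding bounded_iff by blast
  have "norm (v q) \<le> 2 * R" for q
    using neighbor_vertex_norm_le assms(10) R by blast
  then have "x = 0" if "x \<in> address M e T s" for x
    using expanding_bounded_orbit_zero[OF assms(3)]
      address_orbit_bounded[OF inv assms(9) path R _ that] by blast
  then show ?thesis using address_nonempty[OF assms(6-8,11)] by blast
qed

end
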